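(* Let $B$ be a finite nonempty subset of $\mathbb{N}=\{0,1,2,\dots\}$ (a packing body). Let $T^* \subseteq \mathbb{N}$ be a translation set for $B$ that is germ-maximal among translation sets for $B$, i.e. there is no translation set $T$ for $B$ with $T^* \prec T$. Then $T^*$ is rational, i.e. eventually periodic: there exist $N \in \mathbb{N}$ and $d \geq 1$ such that for all $n \geq N$, $n \in T^*$ if and only if $n+d \in T^*$.
   Context: A set $T \subseteq \mathbb{N}$ is a translation set for $B$ iff the translates $B+n=\{b+n : b\in B\}$, for $n \in T$, are pairwise disjoint. For $S \subseteq \mathbb{N}$, its generating function is $S_q := \sum_{n \in S} q^n$ for $q \in (-1,1)$. For $S, S' \subseteq \mathbb{N}$, write $S \preceq S'$ iff there exists $\epsilon > 0$ such that $S_q \leq S'_q$ for all $q \in (1-\epsilon,1)$; write $S \prec S'$ iff $S \preceq S'$ and $S \neq S'$. A set is rational iff it is eventually periodic. *)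

theory Defs
  imports "HOL-Analysis.Analysis"
begin

definition translate :: "nat set \<Rightarrow> nat \<Rightarrow> nat set" where
  "translate B n = (\<lambda>b. b + n) ` B"

definition translation_set :: "nat set \<Rightarrow> nat set \<Rightarrow> bool" where
  "translation_set B T \<longleftrightarrow> disjoint_family_on (translate B) T"

text \<open>Meaningful for \<open>-1 < q < 1\<close>, where the series converges absolutely.\<close>

definition gen_fun :: "nat set \<Rightarrow> real \<Rightarrow> real" where
  "gen_fun S q = (\<Sum>\<^sub>\<infinity>n\<in>S. q ^ n)"

text \<open>A witness \<open>\<epsilon>\<close> may always be shrunk, so not requiring \<open>\<epsilon> \<le> 2\<close>, which would keep
  \<open>q\<close> inside \<open>(-1, 1)\<close>, does not affect the relation.\<close>

definition germ_le :: "nat set \<Rightarrow> nat set \<Rightarrow> bool"  (infix "\<preceq>\<^sub>g" 50) where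
  "S \<preceq>\<^sub>g S' \<longleftrightarrow> (\<exists>\<epsilon>>0. \<forall>q\<in>{1 - \<epsilon><..<1}. gen_fun S q \<le> gen_fun S' q)"

definition germ_less :: "nat set \<Rightarrow> nat set \<Rightarrow> bool"  (infix "\<prec>\<^sub>g" 50) where
  "S \<prec>\<^sub>g S' \<longleftrightarrow> S \<preceq>\<^sub>g S' \<and> S \<noteq> S'"

definition germ_maximal_translation_set :: "nat set \<Rightarrow> nat set \<Rightarrow> bool" where
  "germ_maximal_translation_set B T \<longleftrightarrow>
     translation_set B T \<and> \<not> (\<exists>T'. translation_set B T' \<and> T \<prec>\<^sub>g T')"

definition rational_set :: "nat set \<Rightarrow> bool" where
  "rational_set S \<longleftrightarrow> (\<exists>N. \<exists>d\<ge>1. \<forall>n\<ge>N. n \<in> S \<longleftrightarrow> n + d \<in> S)"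

end

theory Submission
  imports Defs
begin

text \<open>
  Choosing a translation set for \<open>B\<close> bit by bit is a deterministic Markov decision process: the
  state is the finite set of future positions blocked by the elements chosen so far, the reward is
  \<open>1\<close> for choosing the current position, and \<open>gen_fun T q\<close> is the total reward with discount
  factor \<open>q\<close>. For every fixed \<open>q\<close> some stationary policy is optimal. There are only finitely many
  stationary policies, each produces an eventually periodic set, and the generating functions of
  such sets are rational functions of \<open>q\<close>, hence totally preordered near \<open>1\<close>. So one stationary
  policy is optimal for all \<open>q\<close> close to \<open>1\<close> (Blackwell optimality), and a germ-maximal
  translation set must be the set that it produces.
\<close>

section \<open>Generating functions\<close>

text \<open>Trades the unordered sum over \<open>S\<close> for an ordinary series with an indicator,
  so that splitting and limit arguments apply.\<close>

lemma gen_fun_sums: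
  assumes "\<bar>q\<bar> < 1"
  shows "(\<lambda>n. of_bool (n \<in> S) * q ^ n) sums gen_fun S q"
proof -
  have "(\<lambda>n. norm (q ^ n)) summable_on UNIV"
    using assms by (subst summable_on_UNIV_nonneg_real_iff) (auto simp: power_abs)
  then have "(\<lambda>n. q ^ n) summable_on UNIV"
    by (rule abs_summable_summable)
  then have "(\<lambda>n. q ^ n) summable_on S"
    by (rule summable_on_subset_banach) simp
  then have "((\<lambda>n. q ^ n) has_sum gen_fun S q) S"
    unfolding gen_fun_def by (rule has_sum_infsum)
  then have "((\<lambda>n. of_bool (n \<in> S) * q ^ n) has_sum gen_fun S q) UNIV"
    by (subst has_sum_cong_neutral[where T = S and g = "\<lambda>n. q ^ n"]) auto
  then show ?thesis
    by (rule has_sum_imp_sums)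
qed

lemma gen_fun_split:
  assumes "\<bar>q\<bar> < 1"
  shows "gen_fun S q = (\<Sum>k<n. of_bool (k \<in> S) * q ^ k) + q ^ n * gen_fun {k. k + n \<in> S} q"
proof -
  let ?f = "\<lambda>k. of_bool (k \<in> S) * q ^ k"
  have "(\<lambda>k. q ^ n * (of_bool (k \<in> {k. k + n \<in> S}) * q ^ k)) sums
      (q ^ n * gen_fun {k. k + n \<in> S} q)"
    by (intro sums_mult gen_fun_sums assms)
  then have "(\<lambda>k. ?f (k + n)) sums (q ^ n * gen_fun {k. k + n \<in> S} q)"
    by (simp add: power_add mult_ac)
  then have "?f sums (q ^ n * gen_fun {k. k + n \<in> S} q + (\<Sum>k<n. ?f k))"
    by (subst (asm) sums_iff_shift) (simp only: add.commute)
  then show ?thesis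
    using gen_fun_sums[OF assms, of S] by (simp add: sums_unique2 add.commute)
qed

lemma gen_fun_Suc:
  assumes "\<bar>q\<bar> < 1"
  shows "gen_fun S q = of_bool (0 \<in> S) + q * gen_fun {k. Suc k \<in> S} q"
  using gen_fun_split[OF assms, of S 1] by simp

lemma gen_fun_le:
  assumes "0 \<le> q" "q < 1"
  shows "gen_fun S q \<le> 1 / (1 - q)"
proof (rule sums_le)
  show "(\<lambda>n. of_bool (n \<in> S) * q ^ n) sums gen_fun S q"
    using assms by (intro gen_fun_sums) auto
  show "(\<lambda>n. q ^ n) sums (1 / (1 - q))"
    using assms by (intro geometric_sums) auto
  show "of_bool (n \<in> S) * q ^ n \<le> q ^ n" for n
    using assms by simp
qed

text \<open>The tail \<open>S'\<close> beyond the preperiod is invariant under the shift by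
  \<open>d\<close>, so its generating function solves \<open>g = b + q ^ d * g\<close>, where
  \<open>b\<close> is the polynomial of one period.\<close>

lemma rational_set_gen_fun:
  assumes "rational_set S"
  obtains d p where "d \<ge> 1" "\<And>q. \<bar>q\<bar> < 1 \<Longrightarrow> gen_fun S q * (1 - q ^ d) = poly p q"
proof -
  obtain N d where "d \<ge> 1" and per: "\<And>n. n \<ge> N \<Longrightarrow> n \<in> S \<longleftrightarrow> n + d \<in> S"
    using assms unfolding rational_set_def by blast
  define S' where "S' = {k. k + N \<in> S}"
  have S'_shift: "{k. k + d \<in> S'} = S'"
  proof -
    have "k + d + N \<in> S \<longleftrightarrow> k + N \<in> S" for k
      using per[of "k + N"] by (simp add: add_ac)
    then show ?thesis
      unfolding S'_def by blast
  qed
  define a where "a = (\<Sum>k<N. monom (of_bool (k \<in> S)) k :: real poly)"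
  define b where "b = (\<Sum>k<d. monom (of_bool (k \<in> S')) k :: real poly)"
  have "gen_fun S q * (1 - q ^ d) = poly (a * (1 - monom 1 d) + monom 1 N * b) q"
    if q: "\<bar>q\<bar> < 1" for q
  proof -
    have "gen_fun S q = poly a q + q ^ N * gen_fun S' q"
      using gen_fun_split[OF q, of S N] by (simp add: a_def S'_def poly_sum poly_monom)
    moreover have "gen_fun S' q = poly b q + q ^ d * gen_fun S' q"
      using gen_fun_split[OF q, of S' d] by (simp add: b_def S'_shift poly_sum poly_monom)
    then have "gen_fun S' q * (1 - q ^ d) = poly b q"
      by (simp add: algebra_simps)
    ultimately show ?thesis
      by (simp add: poly_monom distrib_right mult.assoc)
  qed
  with \<open>d \<ge> 1\<close> show thesis
    by (rule that)
qed

section \<open>Comparison of germs\<close>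

lemma germ_le_iff_eventually:
  "S \<preceq>\<^sub>g S' \<longleftrightarrow> (\<forall>\<^sub>F q in at_left 1. gen_fun S q \<le> gen_fun S' q)"
proof
  assume "S \<preceq>\<^sub>g S'"
  then obtain \<epsilon> where "\<epsilon> > 0" "\<forall>q\<in>{1 - \<epsilon><..<1}. gen_fun S q \<le> gen_fun S' q"
    unfolding germ_le_def by blast
  then show "\<forall>\<^sub>F q in at_left 1. gen_fun S q \<le> gen_fun S' q"
    unfolding eventually_at_left_field by (intro exI[of _ "1 - \<epsilon>"]) auto
next
  assume "\<forall>\<^sub>F q in at_left 1. gen_fun S q \<le> gen_fun S' q"
  then obtain b where "b < 1" "\<forall>q>b. q < 1 \<longrightarrow> gen_fun S q \<le> gen_fun S' q"
    unfolding eventually_at_left_field by blast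
  then show "S \<preceq>\<^sub>g S'"
    unfolding germ_le_def by (intro exI[of _ "1 - b"]) auto
qed

lemma germ_le_trans:
  assumes "R \<preceq>\<^sub>g S" "S \<preceq>\<^sub>g T"
  shows "R \<preceq>\<^sub>g T"
  using assms unfolding germ_le_iff_eventually by eventually_elim simp

text \<open>Split off the full power of \<open>x - a\<close>: it has constant sign to the left of
  \<open>a\<close>, and so has the cofactor \<open>r\<close> near \<open>a\<close>, by continuity
  and \<open>poly r a \<noteq> 0\<close>.\<close>

lemma poly_sign_at_left:
  fixes p :: "real poly"
  shows "(\<forall>\<^sub>F x in at_left a. poly p x \<ge> 0) \<or> (\<forall>\<^sub>F x in at_left a. poly p x \<le> 0)"
proof (cases "p = 0")
  case False
  obtain r where p: "p = [:- a, 1:] ^ order a p * r" and "\<not> [:- a, 1:] dvd r"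
    using order_decomp[OF False] by blast
  then have "poly r a \<noteq> 0"
    by (simp add: poly_eq_0_iff_dvd)
  \<comment> \<open>\<open>c\<close> carries the sign of \<open>p\<close> just left of
    \<open>a\<close>; the factor \<open>(- 1) ^ order a p\<close> accounts for
    \<open>x - a < 0\<close>.\<close>
  define c where "c = (- 1) ^ order a p * poly r a"
  have "((\<lambda>x. poly r x * poly r a) \<longlongrightarrow> poly r a * poly r a) (at_left a)"
    by (intro tendsto_intros)
  moreover have "poly r a * poly r a > 0"
    using \<open>poly r a \<noteq> 0\<close> by (simp add: zero_less_mult_iff) linarith
  ultimately have "\<forall>\<^sub>F x in at_left a. poly r x * poly r a > 0"
    by (rule order_tendstoD)
  moreover have "\<forall>\<^sub>F x in at_left a. x < a"
    by (simp add: eventually_at_filter)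
  ultimately have sgn: "\<forall>\<^sub>F x in at_left a. poly p x * c > 0"
  proof eventually_elim
    case (elim x)
    have "poly p x * c = ((x - a) * - 1) ^ order a p * (poly r x * poly r a)"
      unfolding power_mult_distrib by (subst p) (simp add: c_def mult_ac)
    with elim show ?case
      by simp
  qed
  show ?thesis
  proof (cases "c \<ge> 0")
    case True
    then have "\<forall>\<^sub>F x in at_left a. poly p x \<ge> 0"
      using sgn by (auto elim!: eventually_mono simp: zero_less_mult_iff)
    then show ?thesis ..
  next
    case False
    then have "\<forall>\<^sub>F x in at_left a. poly p x \<le> 0"
      using sgn by (auto elim!: eventually_mono simp: zero_less_mult_iff)
    then show ?thesis ..
  qed
qed simp

text \<open>Multiplying the difference of the two generating functions by the positive factor
  \<open>c\<close> gives a polynomial in \<open>q\<close>, whose sign is constant just left of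
  1.\<close>

lemma rational_set_germ_le_total:
  assumes "rational_set S" "rational_set S'"
  shows "S \<preceq>\<^sub>g S' \<or> S' \<preceq>\<^sub>g S"
proof -
  obtain d p where "d \<ge> 1" and p: "\<And>q. \<bar>q\<bar> < 1 \<Longrightarrow> gen_fun S q * (1 - q ^ d) = poly p q"
    using rational_set_gen_fun[OF assms(1)] by blast
  obtain d' p' where "d' \<ge> 1" and p': "\<And>q. \<bar>q\<bar> < 1 \<Longrightarrow> gen_fun S' q * (1 - q ^ d') = poly p' q"
    using rational_set_gen_fun[OF assms(2)] by blast
  define r where "r = p' * (1 - monom 1 d) - p * (1 - monom 1 d')"
  have near: "\<forall>\<^sub>F q in at_left 1. 0 < q \<and> q < (1::real)"
    unfolding eventually_at_left_field by (intro exI[of _ 0]) auto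
  have sgn: "(gen_fun S q \<le> gen_fun S' q \<longleftrightarrow> 0 \<le> poly r q) \<and>
      (gen_fun S' q \<le> gen_fun S q \<longleftrightarrow> poly r q \<le> 0)" if "0 < q \<and> q < 1" for q
  proof -
    define c where "c = (1 - q ^ d) * (1 - q ^ d')"
    have "poly r q = (gen_fun S' q - gen_fun S q) * c"
      using that by (simp add: c_def r_def poly_monom p[symmetric] p'[symmetric] algebra_simps)
    moreover have "c > 0"
      using that \<open>d \<ge> 1\<close> \<open>d' \<ge> 1\<close> by (simp add: c_def power_Suc_less_one power_less_one_iff)
    ultimately show ?thesis
      by (auto simp: zero_le_mult_iff mult_le_0_iff)
  qed
  show ?thesis
    using poly_sign_at_left[of r 1]
  proof
    assume "\<forall>\<^sub>F q in at_left 1. poly r q \<ge> 0"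
    with near have "S \<preceq>\<^sub>g S'"
      unfolding germ_le_iff_eventually by eventually_elim (use sgn in blast)
    then show ?thesis ..
  next
    assume "\<forall>\<^sub>F q in at_left 1. poly r q \<le> 0"
    with near have "S' \<preceq>\<^sub>g S"
      unfolding germ_le_iff_eventually by eventually_elim (use sgn in blast)
    then show ?thesis ..
  qed
qed

lemma finite_rational_sets_germ_greatest:
  assumes "finite \<T>" "\<T> \<noteq> {}" "\<And>T. T \<in> \<T> \<Longrightarrow> rational_set T"
  shows "\<exists>M\<in>\<T>. \<forall>T\<in>\<T>. T \<preceq>\<^sub>g M"
  using assms
proof (induction \<T> rule: finite_ne_induct)
  case (singleton T)
  then show ?case
    using rational_set_germ_le_total by blast
next
  case (insert S \<T>)
  then obtain M where "M \<in> \<T>" and M: "\<forall>T\<in>\<T>. T \<preceq>\<^sub>g M"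
    by auto
  then have "S \<preceq>\<^sub>g M \<or> M \<preceq>\<^sub>g S" "S \<preceq>\<^sub>g S"
    using insert.prems rational_set_germ_le_total by blast+
  then show ?case
    using M \<open>M \<in> \<T>\<close> germ_le_trans by blast
qed

section \<open>Translation sets as a decision process\<close>

text \<open>The positive part of the difference set of \<open>B\<close>: translates by
  \<open>m < n\<close> meet exactly when \<open>n - m\<close> lies in it.\<close>

definition conflicts :: "nat set \<Rightarrow> nat set" where
  "conflicts B = {d. 0 < d \<and> (\<exists>b\<in>B. b + d \<in> B)}"

text \<open>\<open>F\<close> records the positions blocked by earlier choices. Carrying it along
  makes the tail of an admissible set admissible again, as the recursion needs.\<close>

definition admissible :: "nat set \<Rightarrow> nat set \<Rightarrow> nat set \<Rightarrow> bool" where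
  "admissible D F T \<longleftrightarrow> T \<inter> F = {} \<and> (\<forall>n\<in>T. \<forall>d\<in>D. n + d \<notin> T)"

text \<open>Positions are renumbered at each step so that the current one is always 0;
  \<open>a\<close> says whether it was chosen.\<close>

definition next_state :: "nat set \<Rightarrow> nat set \<Rightarrow> bool \<Rightarrow> nat set" where
  "next_state D F a = {k. Suc k \<in> F \<or> a \<and> Suc k \<in> D}"

text \<open>A stationary policy is given by the set \<open>P\<close> of the states in which it chooses the current
  position.\<close>

definition policy_state :: "nat set \<Rightarrow> nat set set \<Rightarrow> nat set \<Rightarrow> nat \<Rightarrow> nat set" where
  "policy_state D P F n = ((\<lambda>G. next_state D G (G \<in> P)) ^^ n) F"

definition policy_set :: "nat set \<Rightarrow> nat set set \<Rightarrow> nat set \<Rightarrow> nat set" where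
  "policy_set D P F = {n. policy_state D P F n \<in> P}"

lemma translation_set_iff_admissible:
  "translation_set B T \<longleftrightarrow> admissible (conflicts B) {} T"
proof
  assume T: "translation_set B T"
  have False if "n \<in> T" "n + d \<in> T" "0 < d" "b \<in> B" "b + d \<in> B" for n d b
  proof -
    have "translate B n \<inter> translate B (n + d) = {}"
      using T that unfolding translation_set_def disjoint_family_on_def by simp
    moreover have "b + d + n \<in> translate B n" "b + (n + d) \<in> translate B (n + d)"
      using that by (auto simp: translate_def)
    ultimately show False
      by (metis IntI add.assoc add.commute empty_iff)
  qed
  then show "admissible (conflicts B) {} T"
    unfolding admissible_def conflicts_def by blast
next
  assume T: "admissible (conflicts B) {} T"
  have *: "translate B m \<inter> translate B n = {}" if "m \<in> T" "n \<in> T" "m < n" for m n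
  proof (rule ccontr)
    assume "translate B m \<inter> translate B n \<noteq> {}"
    then obtain b c where "b \<in> B" "c \<in> B" "b + m = c + n"
      unfolding translate_def by auto
    then have "c + (n - m) \<in> B"
      using \<open>m < n\<close> by (metis Nat.add_diff_assoc add_diff_cancel_right' less_imp_le)
    with \<open>c \<in> B\<close> \<open>m < n\<close> have "n - m \<in> conflicts B"
      by (auto simp: conflicts_def)
    with T that have "m + (n - m) \<notin> T"
      unfolding admissible_def by blast
    with that show False
      by simp
  qed
  then show "translation_set B T"
    unfolding translation_set_def disjoint_family_on_def by (metis Int_commute nat_neq_iff)
qed

lemma admissible_Suc:
  assumes "admissible D F T"
  shows "0 \<in> T \<Longrightarrow> 0 \<notin> F"
    and "admissible D (next_state D F (0 \<in> T)) {k. Suc k \<in> T}"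
  using assms unfolding admissible_def next_state_def by force+

lemma policy_state_0 [simp]: "policy_state D P F 0 = F"
  by (simp add: policy_state_def)

lemma policy_state_Suc:
  "policy_state D P F (Suc n) = next_state D (policy_state D P F n) (policy_state D P F n \<in> P)"
  by (simp add: policy_state_def)

lemma policy_state_add:
  "policy_state D P F (m + n) = policy_state D P (policy_state D P F m) n"
  by (simp add: policy_state_def funpow_add add.commute[of m n])

lemma policy_state_blocked:
  "k + n \<in> F \<Longrightarrow> k \<in> policy_state D P F n"
  by (induction n arbitrary: k) (auto simp: policy_state_Suc next_state_def)

text \<open>A blocked position stays blocked until it becomes position 0, and there a policy whose
  states all avoid 0 declines it.\<close>

lemma admissible_policy_set:
  assumes "\<And>G. G \<in> P \<Longrightarrow> 0 \<notin> G" "0 \<notin> D"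
  shows "admissible D F (policy_set D P F)"
proof -
  have "n \<notin> policy_set D P F" if "n \<in> F" for n
    using policy_state_blocked[of 0 n F D P] that assms(1) by (auto simp: policy_set_def)
  moreover have "n + d \<notin> policy_set D P F" if n: "n \<in> policy_set D P F" and "d \<in> D" for n d
  proof -
    obtain e where d: "d = Suc e"
      using \<open>d \<in> D\<close> \<open>0 \<notin> D\<close> by (cases d) auto
    \<comment> \<open>Choosing \<open>n\<close> blocks distance \<open>d = Suc e\<close>, which
      after the shift to state \<open>Suc n\<close> reads \<open>e\<close>; it reaches 0 after
      \<open>e\<close> more steps.\<close>
    have "0 + e \<in> policy_state D P F (Suc n)"
      using n \<open>d \<in> D\<close> by (simp add: policy_state_Suc next_state_def policy_set_def d)
    then have "0 \<in> policy_state D P (policy_state D P F (Suc n)) e"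
      by (rule policy_state_blocked)
    then have "0 \<in> policy_state D P F (n + d)"
      using policy_state_add[of D P F "Suc n" e] by (simp add: d)
    with assms(1) show ?thesis
      by (auto simp: policy_set_def)
  qed
  ultimately show ?thesis
    unfolding admissible_def by blast
qed

lemma policy_state_bounded:
  assumes "D \<subseteq> {..M}" "F \<subseteq> {..M}"
  shows "policy_state D P F n \<subseteq> {..M}"
proof (induction n)
  case (Suc n)
  with assms(1) show ?case
    unfolding policy_state_Suc next_state_def by (fastforce dest: Suc_leD)
qed (simp add: assms)

text \<open>The states evolve deterministically inside the finite set \<open>Pow {..M}\<close>, so
  one recurs and the sequence cycles from there.\<close>

lemma rational_policy_set:
  assumes "D \<subseteq> {..M}" "F \<subseteq> {..M}"
  shows "rational_set (policy_set D P F)"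
proof -
  let ?s = "policy_state D P F"
  have "finite (range ?s)"
    by (rule finite_subset[of _ "Pow {..M}"]) (use policy_state_bounded[OF assms] in auto)
  then have "\<not> inj ?s"
    using finite_imageD infinite_UNIV_nat by blast
  then obtain i j where "i < j" and eq: "?s i = ?s j"
    unfolding inj_def by (metis nat_neq_iff)
  have "?s (n + (j - i)) = ?s n" if "n \<ge> i" for n
  proof -
    have "?s (n + (j - i)) = ?s (j + (n - i))"
      using that \<open>i < j\<close> by (simp add: add.commute)
    also have "\<dots> = ?s (i + (n - i))"
      by (simp only: policy_state_add eq)
    finally show ?thesis
      using that by simp
  qed
  then show ?thesis
    unfolding rational_set_def policy_set_def
    using \<open>i < j\<close> by (intro exI[of _ i] exI[of _ "j - i"]) auto
qed

text \<open>The policy that is greedy for the optimal value function \<open>V\<close> attains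
  \<open>V F\<close>. It may depend on \<open>q\<close>, but it comes from a finite range that does
  not.\<close>

lemma exists_optimal_policy:
  assumes "0 < q" "q < 1" "D \<subseteq> {..M}" "F \<subseteq> {..M}"
  obtains P where "P \<subseteq> {G. G \<subseteq> {..M} \<and> 0 \<notin> G}"
    "\<And>T. admissible D F T \<Longrightarrow> gen_fun T q \<le> gen_fun (policy_set D P F) q"
proof -
  have q: "\<bar>q\<bar> < 1"
    using assms by simp
  define V where "V G = (SUP T\<in>{T. admissible D G T}. gen_fun T q)" for G
  have bdd: "bdd_above ((\<lambda>T. gen_fun T q) ` {T. admissible D G T})" for G
    using gen_fun_le[of q] assms by (intro bdd_aboveI2[where M = "1 / (1 - q)"]) auto
  have ne: "{T. admissible D G T} \<noteq> {}" for G
    by (auto simp: admissible_def)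
  have gen_fun_le_V: "gen_fun T q \<le> V G" if "admissible D G T" for T G
    unfolding V_def using bdd that by (intro cSUP_upper) auto
  have V_le: "V G \<le> 1 / (1 - q)" for G
    unfolding V_def using ne gen_fun_le[of q] assms by (intro cSUP_least) auto
  \<comment> \<open>Choose the current position if it is free and choosing is at least as good as
    skipping, judged by \<open>V\<close> of the successor states.\<close>
  define P where "P = {G. G \<subseteq> {..M} \<and> 0 \<notin> G \<and>
    q * V (next_state D G False) \<le> 1 + q * V (next_state D G True)}"
  have Bellman: "V G \<le> of_bool (G \<in> P) + q * V (next_state D G (G \<in> P))" if "G \<subseteq> {..M}" for G
    unfolding V_def[of G]
  proof (rule cSUP_least[OF ne])
    fix T assume "T \<in> {T. admissible D G T}"
    then have T: "admissible D G T"
      by simp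
    have "gen_fun T q = of_bool (0 \<in> T) + q * gen_fun {k. Suc k \<in> T} q"
      by (rule gen_fun_Suc[OF q])
    also have "\<dots> \<le> of_bool (0 \<in> T) + q * V (next_state D G (0 \<in> T))"
      using gen_fun_le_V[OF admissible_Suc(2)[OF T]] assms(1) by simp
    \<comment> \<open>If \<open>0 \<in> T\<close> then \<open>0 \<notin> G\<close>, so membership in
      \<open>P\<close> rests on the comparison alone; if \<open>0 \<notin> T\<close>, either both
      sides skip or \<open>P\<close> prefers choosing.\<close>
    also have "\<dots> \<le> of_bool (G \<in> P) + q * V (next_state D G (G \<in> P))"
      using admissible_Suc(1)[OF T] that by (cases "0 \<in> T") (auto simp: P_def)
    finally show "gen_fun T q \<le> of_bool (G \<in> P) + q * V (next_state D G (G \<in> P))" .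
  qed
  let ?T = "policy_set D P F"
  let ?s = "\<lambda>n. \<Sum>k<n. of_bool (k \<in> ?T) * q ^ k"
  \<comment> \<open>Bellman's inequality unrolled \<open>n\<close> times; as \<open>V\<close> is
    bounded, the remainder vanishes in the limit.\<close>
  have partial: "V F \<le> ?s n + q ^ n * V (policy_state D P F n)" for n
  proof (induction n)
    case (Suc n)
    let ?G = "policy_state D P F n"
    have "q ^ n * V ?G \<le> q ^ n * (of_bool (?G \<in> P) + q * V (next_state D ?G (?G \<in> P)))"
      using policy_state_bounded[OF assms(3,4)] assms(1) by (intro mult_left_mono Bellman) auto
    with Suc show ?case
      by (simp add: policy_state_Suc policy_set_def algebra_simps)
  qed simp
  have "V F \<le> gen_fun ?T q"
  proof (rule LIMSEQ_le_const)
    have "?s \<longlonglongrightarrow> gen_fun ?T q"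
      using gen_fun_sums[OF q] by (simp add: sums_def)
    moreover have "(\<lambda>n. q ^ n * (1 / (1 - q))) \<longlonglongrightarrow> 0 * (1 / (1 - q))"
      using q by (intro tendsto_mult LIMSEQ_power_zero tendsto_const) simp
    ultimately show "(\<lambda>n. ?s n + q ^ n * (1 / (1 - q))) \<longlonglongrightarrow> gen_fun ?T q"
      using tendsto_add by fastforce
    have "V F \<le> ?s n + q ^ n * (1 / (1 - q))" for n
      using partial[of n] mult_left_mono[OF V_le, of "q ^ n" "policy_state D P F n"] assms(1)
      by simp
    then show "\<exists>N. \<forall>n\<ge>N. V F \<le> ?s n + q ^ n * (1 / (1 - q))"
      by blast
  qed
  show thesis
  proof
    show "P \<subseteq> {G. G \<subseteq> {..M} \<and> 0 \<notin> G}"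
      by (auto simp: P_def)
    show "gen_fun T q \<le> gen_fun ?T q" if "admissible D F T" for T
      using gen_fun_le_V[OF that] \<open>V F \<le> gen_fun ?T q\<close> by simp
  qed
qed

lemma exists_rational_germ_greatest_translation_set:
  assumes "finite B"
  obtains R where "translation_set B R" "rational_set R" "\<And>T. translation_set B T \<Longrightarrow> T \<preceq>\<^sub>g R"
proof -
  define D where "D = conflicts B"
  \<comment> \<open>Inserting 0 keeps \<open>Max\<close> meaningful when \<open>B\<close> is
    empty.\<close>
  define M where "M = Max (insert 0 B)"
  have "D \<subseteq> {..M}"
  proof
    fix d assume "d \<in> D"
    then obtain b where "b + d \<in> B"
      by (auto simp: D_def conflicts_def)
    then have "b + d \<le> M"
      unfolding M_def using assms by (intro Max_ge) auto
    then show "d \<in> {..M}"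
      by simp
  qed
  define \<P> where "\<P> = Pow {G. G \<subseteq> {..M} \<and> 0 \<notin> G}"
  define \<T> where "\<T> = (\<lambda>P. policy_set D P {}) ` \<P>"
  have "finite {G. G \<subseteq> {..M} \<and> 0 \<notin> G}"
    by (rule finite_subset[of _ "Pow {..M}"]) auto
  then have "finite \<T>"
    by (simp add: \<T>_def \<P>_def)
  moreover have "\<T> \<noteq> {}"
    by (auto simp: \<T>_def \<P>_def)
  moreover have rat: "rational_set T" if "T \<in> \<T>" for T
    using that rational_policy_set[OF \<open>D \<subseteq> {..M}\<close>] by (auto simp: \<T>_def)
  ultimately obtain R where "R \<in> \<T>" and R: "\<forall>T\<in>\<T>. T \<preceq>\<^sub>g R"
    using finite_rational_sets_germ_greatest by blast
  show thesis
  proof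
    show "rational_set R"
      using rat \<open>R \<in> \<T>\<close> by blast
    obtain P where P: "P \<in> \<P>" "R = policy_set D P {}"
      using \<open>R \<in> \<T>\<close> by (auto simp: \<T>_def)
    have "admissible D {} R"
      unfolding P(2)
      by (rule admissible_policy_set) (use P(1) in \<open>auto simp: \<P>_def D_def conflicts_def\<close>)
    then show "translation_set B R"
      by (simp add: translation_set_iff_admissible D_def)
  next
    fix T assume "translation_set B T"
    then have T: "admissible D {} T"
      by (simp add: translation_set_iff_admissible D_def)
    \<comment> \<open>Finiteness of \<open>\<T>\<close> gives one neighbourhood on which
      \<open>R\<close> beats every policy set. This uniformity is essential, since the optimal
      policy picked below varies with \<open>q\<close>.\<close>
    have "\<forall>\<^sub>F q in at_left 1. \<forall>S\<in>\<T>. gen_fun S q \<le> gen_fun R q"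
      using R \<open>finite \<T>\<close> by (intro eventually_ball_finite) (auto simp: germ_le_iff_eventually)
    moreover have "\<forall>\<^sub>F q in at_left 1. 0 < q \<and> q < (1::real)"
      unfolding eventually_at_left_field by (intro exI[of _ 0]) auto
    ultimately show "T \<preceq>\<^sub>g R"
      unfolding germ_le_iff_eventually
    proof eventually_elim
      case (elim q)
      then obtain P where "P \<in> \<P>" "gen_fun T q \<le> gen_fun (policy_set D P {}) q"
        using exists_optimal_policy[OF _ _ \<open>D \<subseteq> {..M}\<close>, of q "{}"] T
        unfolding \<P>_def by (metis PowI empty_subsetI)
      moreover from \<open>P \<in> \<P>\<close> have "gen_fun (policy_set D P {}) q \<le> gen_fun R q"
        using elim(1) by (simp add: \<T>_def)
      ultimately show ?case
        by simp
    qed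
  qed
qed

theorem theorem2:
  fixes B T :: "nat set"
  assumes "finite B" and "B \<noteq> {}"
    and "germ_maximal_translation_set B T"
  shows "rational_set T"
proof -
  obtain R where "translation_set B R" "rational_set R" "\<And>T. translation_set B T \<Longrightarrow> T \<preceq>\<^sub>g R"
    using exists_rational_germ_greatest_translation_set[OF \<open>finite B\<close>] by blast
  \<comment> \<open>\<open>germ_less\<close> demands only inequality as sets besides
    \<open>T \<preceq>\<^sub>g R\<close>, so maximality of \<open>T\<close> forces equality of
    sets.\<close>
  with assms(3) have "T = R"
    unfolding germ_maximal_translation_set_def germ_less_def by blast
  with \<open>rational_set R\<close> show ?thesis
    by simp
qed

end
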